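(* Let $H$ be a simple graph with vertex set $\{1,2,\ldots,l\}$ and let $H_1,\ldots,H_l$ be vertex-disjoint simple graphs of order $n$ each, which are commuting (their adjacency matrices pairwise commute), with $H_j$ being $r_j$-regular for $j=1,\ldots,l$. Let $u_1=\frac{1}{\sqrt n}j_n,u_2,\ldots,u_n$ be an orthonormal basis of $\mathbb{R}^n$ consisting of common eigenvectors of $A(H_1),\ldots,A(H_l)$, and let $A(H_j)u_i=\lambda_{i,j}u_i$ (so $\lambda_{1,j}=r_j$). For $1\le j,k\le l$ let $\rho_{j,k}=\rho_{k,j}=1$ if $jk\in E(H)$ and $0$ otherwise, and put $d_j=\sum_{k\neq j}\rho_{j,k}$. Let $\alpha\neq 0$ and $\beta,\gamma,\eta\in\mathbb{R}$. Then the spectrum of the universal adjacency matrix $U(\widehat G)=\alpha A(\widehat G)+\beta D(\widehat G)+\gamma I+\eta J$ of $\widehat G=\Lambda_H(H_1,\ldots,H_l)$ is the union (as multisets) of the spectrum of the $l\times l$ matrix $C_1$ with entries \[ (C_1)_{jj}=\alpha r_j+(r_j+d_j)\beta+\gamma+n\eta,\qquad (C_1)_{jk}=\rho_{j,k}\alpha+n\eta\ (j\neq k), \] and the spectra of the $l\times l$ matrices $C_i$, $i=2,\ldots,n$, with entries \[ (C_i)_{jj}=\lambda_{i,j}\alpha+(r_j+d_j)\beta+\gamma,\qquad (C_i)_{jk}=\rho_{j,k}\alpha\ (j\neq k). \]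
   Context: For a graph $G$, $A(G)$ is its adjacency matrix, $D(G)$ the diagonal matrix of vertex degrees, $I$ the identity matrix, $J$ the all-ones matrix (of the size of $G$), and $j_n$ the all-ones column vector of length $n$. Given a graph $H$ on $\{1,\ldots,l\}$ and graphs $H_1,\ldots,H_l$ of the same order $n$ with $V(H_j)=\{v_{j1},\ldots,v_{jn}\}$, the $H$-product $\Lambda_H(H_1,\ldots,H_l)$ is the graph with vertex set $\bigcup_{j}V(H_j)$ and edge set $\bigcup_j E(H_j)\cup\bigcup_{jk\in E(H)}\{v_{ji}v_{ki}: i=1,\ldots,n\}$. *)

theory Defs
  imports
    Jordan_Normal_Form.Char_Poly
    Jordan_Normal_Form.VS_Connect
    Graph_Theory.Pair_Digraph
    "HOL-Computational_Algebra.Computational_Algebra"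
begin

text \<open>
  A simple graph is a \<open>pair_graph\<close>: a finite loop-free digraph whose arcs form a symmetric set of
  pairs, an undirected edge \<open>vw\<close> being the two arcs \<open>(v, w)\<close> and \<open>(w, v)\<close>. Hence
  \<open>out_degree\<close> is the usual vertex degree.
\<close>

definition regular_of_degree :: "nat \<Rightarrow> 'a pair_pre_digraph \<Rightarrow> bool" where
  "regular_of_degree r G \<longleftrightarrow> (\<forall>v\<in>pverts G. out_degree (with_proj G) v = r)"

definition vertex_ordering :: "'a pair_pre_digraph \<Rightarrow> 'a list \<Rightarrow> bool" where
  "vertex_ordering G vs \<longleftrightarrow> distinct vs \<and> set vs = pverts G"

text \<open>Rows and columns of graph matrices follow the order of the vertex list \<open>vs\<close>.\<close>

definition adjacency_mat :: "'a list \<Rightarrow> 'a pair_pre_digraph \<Rightarrow> real mat" where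
  "adjacency_mat vs G = mat (length vs) (length vs)
     (\<lambda>(a, b). if (vs ! a, vs ! b) \<in> parcs G then 1 else 0)"

definition deg_mat :: "'a list \<Rightarrow> 'a pair_pre_digraph \<Rightarrow> real mat" where
  "deg_mat vs G = mat (length vs) (length vs)
     (\<lambda>(a, b). if a = b then real (out_degree (with_proj G) (vs ! a)) else 0)"

definition ones_mat :: "nat \<Rightarrow> real mat" where
  "ones_mat m = mat m m (\<lambda>_. 1)"

definition ones_vec :: "nat \<Rightarrow> real vec" where
  "ones_vec m = vec m (\<lambda>_. 1)"

definition universal_adj_mat ::
  "real \<Rightarrow> real \<Rightarrow> real \<Rightarrow> real \<Rightarrow> 'a list \<Rightarrow> 'a pair_pre_digraph \<Rightarrow> real mat" where
  "universal_adj_mat \<alpha> \<beta> \<gamma> \<eta> vs G =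
     \<alpha> \<cdot>\<^sub>m adjacency_mat vs G + \<beta> \<cdot>\<^sub>m deg_mat vs G
     + \<gamma> \<cdot>\<^sub>m 1\<^sub>m (length vs) + \<eta> \<cdot>\<^sub>m ones_mat (length vs)"

text \<open>
  The multiset of all complex eigenvalues, counted with algebraic multiplicity; for an
  \<open>m \<times> m\<close> matrix it always has \<open>m\<close> elements.
\<close>

definition spectrum_mset :: "real mat \<Rightarrow> complex multiset" where
  "spectrum_mset A = proots (char_poly (map_mat complex_of_real A))"

text \<open>
  The \<open>H\<close>-product of the graphs \<open>Hs j\<close>, where \<open>vs j\<close> lists the vertices
  \<open>v\<^sub>j\<^sub>1, \<dots>, v\<^sub>j\<^sub>n\<close> of \<open>Hs j\<close>. As \<open>parcs H\<close> is symmetric, the matching arcs come in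
  both directions.
\<close>

definition H_product ::
  "nat pair_pre_digraph \<Rightarrow> (nat \<Rightarrow> 'a pair_pre_digraph) \<Rightarrow> (nat \<Rightarrow> 'a list) \<Rightarrow> 'a pair_pre_digraph" where
  "H_product H Hs vs =
     \<lparr> pverts = (\<Union>j\<in>pverts H. pverts (Hs j)),
       parcs = (\<Union>j\<in>pverts H. parcs (Hs j)) \<union>
               {(vs j ! i, vs k ! i) | j k i. (j, k) \<in> parcs H \<and> i < length (vs j)} \<rparr>"

definition orthonormal_basis :: "nat \<Rightarrow> (nat \<Rightarrow> real vec) \<Rightarrow> bool" where
  "orthonormal_basis n u \<longleftrightarrow>
     vectorspace.basis class_ring (module_vec TYPE(real) n) (u ` {1..n}) \<and>
     (\<forall>i\<in>{1..n}. \<forall>k\<in>{1..n}. u i \<bullet> u k = (if i = k then 1 else 0))"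

definition rho :: "nat pair_pre_digraph \<Rightarrow> nat \<Rightarrow> nat \<Rightarrow> real" where
  "rho H j k = (if (j, k) \<in> parcs H then 1 else 0)"

definition H_deg :: "nat pair_pre_digraph \<Rightarrow> nat \<Rightarrow> real" where
  "H_deg H j = (\<Sum>k\<in>pverts H - {j}. rho H j k)"

text \<open>
  The \<open>l \<times> l\<close> matrix given by its entries at \<open>1 \<le> j, k \<le> l\<close>; matrix positions are counted from 0
  in the library.
\<close>

definition mat1 :: "nat \<Rightarrow> (nat \<Rightarrow> nat \<Rightarrow> real) \<Rightarrow> real mat" where
  "mat1 l f = mat l l (\<lambda>(a, b). f (Suc a) (Suc b))"

end

theory Submission
  imports Defs
begin

text \<open>
  For an eigenvector \<open>u\<^sub>i\<close> and a factor \<open>H\<^sub>j\<close>, extend \<open>u\<^sub>i\<close> by zero from \<open>V(H\<^sub>j)\<close> to all vertices of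
  the product. These \<open>n l\<close> vectors form an orthonormal basis. For fixed \<open>i\<close>, the span of the \<open>l\<close>
  vectors belonging to \<open>u\<^sub>i\<close> is invariant under the universal adjacency matrix, which acts on it by
  \<open>C\<^sub>i\<close>: the matching edges between two factors act as the identity on \<open>u\<^sub>i\<close>, and \<open>J\<close> only sees the sum
  of the entries of \<open>u\<^sub>i\<close>, which vanishes unless \<open>i = 1\<close>. Hence the universal adjacency matrix is similar
  to the block diagonal matrix of \<open>C\<^sub>1, \<dots>, C\<^sub>n\<close>.
\<close>

section \<open>Block diagonal matrices\<close>

text \<open>All blocks share the size \<open>l\<close>, so \<open>div\<close> and \<open>mod\<close>
  recover the block and the position in it. The columns of \<open>lift_mat\<close> are numbered in
  the same way, which makes the two matrices fit together.\<close>

definition block_diag :: "nat \<Rightarrow> nat \<Rightarrow> (nat \<Rightarrow> 'a :: zero mat) \<Rightarrow> 'a mat" where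
  "block_diag m l B = mat (m * l) (m * l)
     (\<lambda>(a, b). if a div l = b div l then B (a div l) $$ (a mod l, b mod l) else 0)"

lemma block_diag_carrier [simp]: "block_diag m l B \<in> carrier_mat (m * l) (m * l)"
  by (simp add: block_diag_def)

text \<open>Splitting off the last block is the induction step for the characteristic
  polynomial.\<close>

lemma block_diag_Suc:
  assumes "\<And>i. i < Suc m \<Longrightarrow> B i \<in> carrier_mat l l"
  shows "block_diag (Suc m) l B =
    four_block_mat (block_diag m l B) (0\<^sub>m (m * l) l) (0\<^sub>m l (m * l)) (B m)"
proof (rule eq_matI)
  have B: "B m \<in> carrier_mat l l"
    using assms by simp
  show "dim_row (block_diag (Suc m) l B) =
      dim_row (four_block_mat (block_diag m l B) (0\<^sub>m (m * l) l) (0\<^sub>m l (m * l)) (B m))"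
    using B by (simp add: block_diag_def)
  show "dim_col (block_diag (Suc m) l B) =
      dim_col (four_block_mat (block_diag m l B) (0\<^sub>m (m * l) l) (0\<^sub>m l (m * l)) (B m))"
    using B by (simp add: block_diag_def)
  fix a b
  assume "a < dim_row (four_block_mat (block_diag m l B) (0\<^sub>m (m * l) l) (0\<^sub>m l (m * l)) (B m))"
    and "b < dim_col (four_block_mat (block_diag m l B) (0\<^sub>m (m * l) l) (0\<^sub>m l (m * l)) (B m))"
  then have ab: "a < m * l + l" "b < m * l + l"
    using B by (auto simp: block_diag_def)
  have pos: "l > 0"
    using ab(1) by (cases l) auto
  have low: "c div l < m" if "c < m * l" for c
    using that by (simp add: less_mult_imp_div_less)
  \<comment> \<open>Past \<open>m * l\<close> an index lies in the last block. It is written as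
    remainder plus multiple of \<open>l\<close>; the deleted simp rules would collapse that sum to
    \<open>c\<close> again.\<close>
  have high: "c div l = m \<and> c mod l = c - m * l" if "\<not> c < m * l" "c < m * l + l" for c
  proof -
    have c: "c = (c - m * l) + m * l" "c - m * l < l"
      using that by auto
    have "((c - m * l) + m * l) div l = m" "((c - m * l) + m * l) mod l = c - m * l"
      using c(2) pos by (simp_all del: le_add_diff_inverse le_add_diff_inverse2)
    then show ?thesis
      using c(1) by simp
  qed
  show "block_diag (Suc m) l B $$ (a, b) =
      four_block_mat (block_diag m l B) (0\<^sub>m (m * l) l) (0\<^sub>m l (m * l)) (B m) $$ (a, b)"
    using ab B low[of a] low[of b] high[of a] high[of b]
    by (cases "a < m * l"; cases "b < m * l") (auto simp: block_diag_def)
qed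

text \<open>Subtracting the matrix from x times the identity keeps the zero blocks, and the
  determinant of a block triangular matrix is the product of the determinants of its diagonal
  blocks.\<close>

lemma char_poly_four_block_zeros:
  fixes A :: "'a :: idom mat"
  assumes A: "A \<in> carrier_mat n n" and D: "D \<in> carrier_mat m m"
  shows "char_poly (four_block_mat A (0\<^sub>m n m) (0\<^sub>m m n) D) = char_poly A * char_poly D"
proof -
  have "char_poly_matrix (four_block_mat A (0\<^sub>m n m) (0\<^sub>m m n) D) =
      four_block_mat (char_poly_matrix A) (0\<^sub>m n m) (0\<^sub>m m n) (char_poly_matrix D)"
    using A D by (intro eq_matI) (auto simp: char_poly_matrix_def)
  then show ?thesis
    using A D unfolding char_poly_def
    by (simp add: det_four_block_mat_upper_right_zero[of _ n _ m])
qed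

lemma char_poly_block_diag:
  fixes B :: "nat \<Rightarrow> 'a :: idom mat"
  assumes "\<And>i. i < m \<Longrightarrow> B i \<in> carrier_mat l l"
  shows "char_poly (block_diag m l B) = (\<Prod>i<m. char_poly (B i))"
  using assms
proof (induction m)
  case 0
  have "block_diag 0 l B \<in> carrier_mat 0 0"
    using block_diag_carrier[of 0 l B] by simp
  then show ?case
    by (simp add: char_poly_def)
next
  case (Suc m)
  then show ?case
    by (simp add: block_diag_Suc char_poly_four_block_zeros)
qed

text \<open>A left inverse of a square matrix is two-sided, so \<open>U\<close> equals
  \<open>P * M * P\<^sup>T\<close> and is similar to \<open>M\<close>. What remains for the
  application is an entrywise check of \<open>U * P = P * M\<close>.\<close>

lemma char_poly_intertwined:
  fixes U M P :: "'a :: field mat"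
  assumes U: "U \<in> carrier_mat N N" and M: "M \<in> carrier_mat N N" and P: "P \<in> carrier_mat N N"
    and orth: "P\<^sup>T * P = 1\<^sub>m N" and UP: "U * P = P * M"
  shows "char_poly U = char_poly M"
proof -
  have Pt: "P\<^sup>T \<in> carrier_mat N N"
    using P by simp
  have inv: "P * P\<^sup>T = 1\<^sub>m N"
    using mat_mult_left_right_inverse[OF Pt P orth] .
  have "U = U * (P * P\<^sup>T)"
    using U inv by simp
  also have "\<dots> = P * M * P\<^sup>T"
    using U P Pt UP by (simp flip: assoc_mult_mat)
  finally have "similar_mat U M"
    using U M P Pt orth inv by (intro similar_matI) auto
  then show ?thesis
    by (rule char_poly_similar)
qed

section \<open>Complex spectra as multisets of roots\<close>

lemma spectrum_mset_char_poly:
  assumes "A \<in> carrier_mat N N"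
  shows "spectrum_mset A = proots (map_poly complex_of_real (char_poly A))"
  by (simp add: spectrum_mset_def of_real_hom.char_poly_hom[OF assms])

lemma spectrum_mset_block_diag:
  assumes U: "U \<in> carrier_mat N N"
    and B: "\<And>i. i < m \<Longrightarrow> B i \<in> carrier_mat l l"
    and eq: "char_poly U = char_poly (block_diag m l B)"
  shows "spectrum_mset U = (\<Sum>i<m. spectrum_mset (B i))"
proof -
  \<comment> \<open>Roots with multiplicity add up over a product only if no factor vanishes;
    characteristic polynomials are monic.\<close>
  have nz: "char_poly (B i) \<noteq> 0" if "i < m" for i
    using degree_monic_char_poly[OF B[OF that]] by auto
  interpret mp: map_poly_inj_idom_hom complex_of_real ..
  have "spectrum_mset U = proots (\<Prod>i<m. map_poly complex_of_real (char_poly (B i)))"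
    by (simp add: spectrum_mset_char_poly[OF U] eq char_poly_block_diag[OF B] mp.hom_prod)
  also have "\<dots> = (\<Sum>i<m. proots (map_poly complex_of_real (char_poly (B i))))"
    using nz by (intro proots_prod) auto
  also have "\<dots> = (\<Sum>i<m. spectrum_mset (B i))"
    by (intro sum.cong) (simp_all add: spectrum_mset_char_poly[OF B])
  finally show ?thesis .
qed

text \<open>The range splits into \<open>m\<close> consecutive intervals of length \<open>l\<close>.
  This turns a row of a product with \<open>block_diag\<close> into a double sum over blocks and
  positions.\<close>

lemma sum_div_mod:
  fixes f :: "nat \<Rightarrow> nat \<Rightarrow> 'a :: comm_monoid_add"
  shows "(\<Sum>c<m * l. f (c div l) (c mod l)) = (\<Sum>i<m. \<Sum>j<l. f i j)"
proof -
  have "(\<Sum>c\<in>{i * l..<i * l + l}. f (c div l) (c mod l)) = (\<Sum>j<l. f i j)" for i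
  proof -
    have "(\<Sum>c\<in>{i * l..<i * l + l}. f (c div l) (c mod l)) =
        (\<Sum>j\<in>{0..<l}. f ((j + i * l) div l) ((j + i * l) mod l))"
      using sum.shift_bounds_nat_ivl[of "\<lambda>c. f (c div l) (c mod l)" 0 "i * l" l]
      by (simp add: add.commute)
    also have "\<dots> = (\<Sum>j<l. f i j)"
      by (rule sum.cong) auto
    finally show ?thesis .
  qed
  then show ?thesis
    by (simp flip: sum.nat_group)
qed

section \<open>Vertices, arcs and degrees of an H-product\<close>

text \<open>Arcs leaving \<open>v\<close> correspond to their heads. As a sum of indicators, the
  degree can be split over the factors of the product.\<close>

lemma real_out_degree_eq_sum:
  assumes "finite (pverts G)" and "parcs G \<subseteq> pverts G \<times> pverts G"
  shows "real (out_degree (with_proj G) v) =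
    (\<Sum>w\<in>pverts G. if (v, w) \<in> parcs G then 1 else 0)"
proof -
  have "out_arcs (with_proj G) v = Pair v ` {w \<in> pverts G. (v, w) \<in> parcs G}"
    using assms(2) by (auto simp: out_arcs_def)
  then have "out_degree (with_proj G) v = card {w \<in> pverts G. (v, w) \<in> parcs G}"
    by (simp add: out_degree_def card_image inj_on_def)
  then show ?thesis
    using assms(1) by (simp add: sum.If_cases Int_def)
qed

lemma adjacency_mat_carrier [simp]:
  "adjacency_mat ws G \<in> carrier_mat (length ws) (length ws)"
  by (simp add: adjacency_mat_def)

lemma universal_adj_mat_carrier [simp]:
  "universal_adj_mat \<alpha> \<beta> \<gamma> \<eta> ws G \<in> carrier_mat (length ws) (length ws)"
  by (simp add: universal_adj_mat_def ones_mat_def)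

text \<open>Indexing by vertices instead of positions lets the computation run without reference to
  the ordering \<open>ws\<close>.\<close>

definition universal_entry ::
  "real \<Rightarrow> real \<Rightarrow> real \<Rightarrow> real \<Rightarrow> 'a pair_pre_digraph \<Rightarrow> 'a \<Rightarrow> 'a \<Rightarrow> real" where
  "universal_entry \<alpha> \<beta> \<gamma> \<eta> G v w = \<alpha> * (if (v, w) \<in> parcs G then 1 else 0)
     + (if v = w then \<beta> * real (out_degree (with_proj G) v) + \<gamma> else 0) + \<eta>"

lemma universal_adj_mat_entry:
  assumes "distinct ws" "a < length ws" "b < length ws"
  shows "universal_adj_mat \<alpha> \<beta> \<gamma> \<eta> ws G $$ (a, b) = universal_entry \<alpha> \<beta> \<gamma> \<eta> G (ws ! a) (ws ! b)"
  using assms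
  by (auto simp: universal_adj_mat_def universal_entry_def adjacency_mat_def deg_mat_def
      ones_mat_def nth_eq_iff_index_eq)

locale H_product_family =
  fixes H :: "nat pair_pre_digraph"
    and Hs :: "nat \<Rightarrow> 'a pair_pre_digraph"
    and vs :: "nat \<Rightarrow> 'a list"
    and l n :: nat
  assumes H: "pair_graph H" "pverts H = {1..l}"
    and Hs: "\<And>j. j \<in> {1..l} \<Longrightarrow> pair_graph (Hs j)"
    and card_Hs: "\<And>j. j \<in> {1..l} \<Longrightarrow> card (pverts (Hs j)) = n"
    and vs: "\<And>j. j \<in> {1..l} \<Longrightarrow> vertex_ordering (Hs j) (vs j)"
    and disj: "disjoint_family_on (\<lambda>j. pverts (Hs j)) {1..l}"
begin

abbreviation "G \<equiv> H_product H Hs vs"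

lemma set_vs: "j \<in> {1..l} \<Longrightarrow> set (vs j) = pverts (Hs j)"
  and distinct_vs: "j \<in> {1..l} \<Longrightarrow> distinct (vs j)"
  using vs by (auto simp: vertex_ordering_def)

lemma length_vs: "j \<in> {1..l} \<Longrightarrow> length (vs j) = n"
  using card_Hs[of j] set_vs[of j] distinct_card[OF distinct_vs[of j]] by simp

lemma vs_nth_in: "j \<in> {1..l} \<Longrightarrow> s < n \<Longrightarrow> vs j ! s \<in> pverts (Hs j)"
  using set_vs length_vs nth_mem by metis

text \<open>Disjointness of the factors determines \<open>j\<close>, distinctness of
  \<open>vs j\<close> determines \<open>s\<close>: the pairs \<open>(j, s)\<close> are coordinates
  on the vertices of the product.\<close>

lemma vs_nth_eq_iff:
  assumes "j \<in> {1..l}" "k \<in> {1..l}" "s < n" "t < n"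
  shows "vs j ! s = vs k ! t \<longleftrightarrow> j = k \<and> s = t"
proof
  assume eq: "vs j ! s = vs k ! t"
  have "j = k"
  proof (rule ccontr)
    assume "j \<noteq> k"
    then have "pverts (Hs j) \<inter> pverts (Hs k) = {}"
      using disj assms by (auto simp: disjoint_family_on_def)
    then show False
      using vs_nth_in[of j s] vs_nth_in[of k t] assms eq by auto
  qed
  then show "j = k \<and> s = t"
    using eq assms distinct_vs length_vs by (simp add: nth_eq_iff_index_eq)
qed simp

lemma pverts_Hs: "j \<in> {1..l} \<Longrightarrow> pverts (Hs j) = (\<lambda>t. vs j ! t) ` {..<n}"
  using set_vs length_vs by (force simp: set_conv_nth)

lemma finite_pverts_Hs: "j \<in> {1..l} \<Longrightarrow> finite (pverts (Hs j))"
  by (simp add: pverts_Hs)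

lemma sum_pverts_Hs:
  "j \<in> {1..l} \<Longrightarrow> (\<Sum>v\<in>pverts (Hs j). f v) = (\<Sum>t<n. f (vs j ! t))"
  by (simp add: pverts_Hs sum.reindex inj_on_def vs_nth_eq_iff)

lemma pverts_G: "pverts G = (\<Union>j\<in>{1..l}. pverts (Hs j))"
  by (simp add: H_product_def H)

lemma finite_pverts_G: "finite (pverts G)"
  by (auto simp: pverts_G pverts_Hs)

lemma sum_pverts_G: "(\<Sum>v\<in>pverts G. f v) = (\<Sum>j\<in>{1..l}. \<Sum>t<n. f (vs j ! t))"
proof -
  have "(\<Sum>v\<in>pverts G. f v) = (\<Sum>j\<in>{1..l}. \<Sum>v\<in>pverts (Hs j). f v)"
    unfolding pverts_G using disj
    by (intro sum.UNION_disjoint) (auto simp: pverts_Hs disjoint_family_on_def)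
  then show ?thesis
    by (simp add: sum_pverts_Hs)
qed

lemma pverts_GE:
  assumes "v \<in> pverts G"
  obtains j t where "j \<in> {1..l}" "t < n" "v = vs j ! t"
  using assms by (auto simp: pverts_G pverts_Hs)

lemma parcs_H_subset: "parcs H \<subseteq> {1..l} \<times> {1..l}"
proof -
  interpret pair_graph H by (rule H)
  show ?thesis
    using in_arcsD1 in_arcsD2 H(2) by auto
qed

lemma parcs_H_irrefl: "(j, j) \<notin> parcs H"
proof -
  interpret pair_graph H by (rule H)
  show ?thesis
    using pair_no_loops[of "(j, j)"] by auto
qed

lemma parcs_Hs_subset: "j \<in> {1..l} \<Longrightarrow> parcs (Hs j) \<subseteq> pverts (Hs j) \<times> pverts (Hs j)"
proof -
  assume "j \<in> {1..l}"
  then interpret pair_graph "Hs j" by (rule Hs)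
  show ?thesis
    using in_arcsD1 in_arcsD2 by auto
qed

lemma parcs_G_subset: "parcs G \<subseteq> pverts G \<times> pverts G"
proof -
  have "(vs j ! i, vs k ! i) \<in> pverts G \<times> pverts G"
    if "(j, k) \<in> parcs H" "i < length (vs j)" for i j k
  proof -
    have jk: "j \<in> {1..l}" "k \<in> {1..l}"
      using that(1) parcs_H_subset by auto
    then show ?thesis
      using that(2) vs_nth_in[of j i] vs_nth_in[of k i] length_vs[of j] unfolding pverts_G by auto
  qed
  moreover have "parcs (Hs j) \<subseteq> pverts G \<times> pverts G" if "j \<in> {1..l}" for j
    using parcs_Hs_subset[OF that] that unfolding pverts_G by blast
  moreover have "parcs G = (\<Union>j\<in>{1..l}. parcs (Hs j)) \<union>
      {(vs j ! i, vs k ! i) | j k i. (j, k) \<in> parcs H \<and> i < length (vs j)}"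
    by (simp add: H_product_def H(2))
  ultimately show ?thesis
    by blast
qed

text \<open>Arcs of a factor stay inside it, and matching arcs join different factors because
  \<open>H\<close> has no loops. So the two kinds of arcs never mix.\<close>

lemma parcs_G_iff:
  assumes "j \<in> {1..l}" "k \<in> {1..l}" "s < n" "t < n"
  shows "(vs j ! s, vs k ! t) \<in> parcs G \<longleftrightarrow>
    (if j = k then (vs j ! s, vs j ! t) \<in> parcs (Hs j) else (j, k) \<in> parcs H \<and> s = t)"
proof -
  have inner: "(vs j ! s, vs k ! t) \<in> parcs (Hs i) \<longleftrightarrow>
      i = j \<and> j = k \<and> (vs j ! s, vs j ! t) \<in> parcs (Hs j)" if i: "i \<in> {1..l}" for i
  proof -
    have "p = i" if "vs p ! q \<in> pverts (Hs i)" "p \<in> {1..l}" "q < n" for p q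
      using that i vs_nth_eq_iff by (auto simp: pverts_Hs)
    then show ?thesis
      using parcs_Hs_subset[OF i] assms by blast
  qed
  \<comment> \<open>By uniqueness of coordinates, the common position \<open>i\<close> of a matching
    arc must equal both \<open>s\<close> and \<open>t\<close>.\<close>
  have outer: "(\<exists>j' k' i. vs j ! s = vs j' ! i \<and> vs k ! t = vs k' ! i \<and> (j', k') \<in> parcs H \<and>
      i < length (vs j')) \<longleftrightarrow> (j, k) \<in> parcs H \<and> s = t" (is "?L \<longleftrightarrow> ?R")
  proof
    assume ?L
    then obtain j' k' i where *: "vs j ! s = vs j' ! i" "vs k ! t = vs k' ! i"
      "(j', k') \<in> parcs H" "i < length (vs j')"
      by blast
    then have jk': "j' \<in> {1..l}" "k' \<in> {1..l}"
      using parcs_H_subset by auto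
    with *(4) have "i < n"
      by (simp add: length_vs)
    then show ?R
      using * jk' assms vs_nth_eq_iff[of j j' s i] vs_nth_eq_iff[of k k' t i] by simp
  next
    assume ?R
    then show ?L
      using assms length_vs by metis
  qed
  have "(vs j ! s, vs k ! t) \<in> parcs G \<longleftrightarrow>
      (\<exists>i\<in>{1..l}. (vs j ! s, vs k ! t) \<in> parcs (Hs i)) \<or>
      (\<exists>j' k' i. vs j ! s = vs j' ! i \<and> vs k ! t = vs k' ! i \<and> (j', k') \<in> parcs H \<and>
        i < length (vs j'))"
    by (auto simp: H_product_def H(2))
  then show ?thesis
    unfolding outer using assms inner parcs_H_irrefl by auto
qed

text \<open>The own factor contributes \<open>r\<close>; every other factor contains at most one
  neighbour, the vertex at the same position \<open>s\<close>, and contributes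
  \<open>rho H j k\<close>.\<close>

lemma out_degree_G:
  assumes j: "j \<in> {1..l}" and s: "s < n" and reg: "regular_of_degree r (Hs j)"
  shows "real (out_degree (with_proj G) (vs j ! s)) = real r + H_deg H j"
proof -
  have own: "(\<Sum>t<n. if (vs j ! s, vs j ! t) \<in> parcs (Hs j) then 1 else (0 :: real)) = real r"
  proof -
    have "real (out_degree (with_proj (Hs j)) (vs j ! s)) = real r"
      using reg j s vs_nth_in by (simp add: regular_of_degree_def)
    then show ?thesis
      by (simp add: real_out_degree_eq_sum[OF finite_pverts_Hs[OF j] parcs_Hs_subset[OF j]]
          sum_pverts_Hs[OF j])
  qed
  have other: "(\<Sum>t<n. if (vs j ! s, vs k ! t) \<in> parcs G then 1 else (0 :: real)) = rho H j k"
    if "k \<in> {1..l} - {j}" for k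
  proof -
    have "(\<Sum>t<n. if (vs j ! s, vs k ! t) \<in> parcs G then 1 else (0 :: real)) =
        (\<Sum>t<n. if t = s then rho H j k else 0)"
      using that j s by (intro sum.cong) (auto simp: parcs_G_iff rho_def)
    then show ?thesis
      using s by simp
  qed
  have "real (out_degree (with_proj G) (vs j ! s)) =
      (\<Sum>k\<in>{1..l}. \<Sum>t<n. if (vs j ! s, vs k ! t) \<in> parcs G then 1 else 0)"
    by (simp add: real_out_degree_eq_sum[OF finite_pverts_G parcs_G_subset] sum_pverts_G)
  also have "\<dots> = (\<Sum>t<n. if (vs j ! s, vs j ! t) \<in> parcs G then 1 else 0) +
      (\<Sum>k\<in>{1..l} - {j}. \<Sum>t<n. if (vs j ! s, vs k ! t) \<in> parcs G then 1 else 0)"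
    using j by (subst sum.remove[of _ j]) auto
  also have "(\<Sum>t<n. if (vs j ! s, vs j ! t) \<in> parcs G then 1 else (0 :: real)) = real r"
    unfolding own[symmetric] using j s by (intro sum.cong) (auto simp: parcs_G_iff)
  also have "(\<Sum>k\<in>{1..l} - {j}. \<Sum>t<n. if (vs j ! s, vs k ! t) \<in> parcs G then 1 else (0 :: real))
      = H_deg H j"
    unfolding H_deg_def H(2) using other by (intro sum.cong) auto
  finally show ?thesis .
qed

section \<open>The action of the universal adjacency matrix\<close>

text \<open>This is the row of the vertex at position \<open>s\<close> of factor \<open>k\<close>,
  applied to \<open>x\<close> placed on factor \<open>j\<close>. Inside a factor the eigenvalue
  equation and the diagonal act; between factors only the matched position \<open>t = s\<close>
  counts. The all-ones matrix adds the sum of \<open>x\<close> in both cases.\<close>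

lemma universal_entry_sum:
  fixes x :: "real vec"
  assumes j: "j \<in> {1..l}" and k: "k \<in> {1..l}" and s: "s < n"
    and reg: "regular_of_degree r (Hs k)"
    and x: "x \<in> carrier_vec n" and eig: "adjacency_mat (vs j) (Hs j) *\<^sub>v x = e \<cdot>\<^sub>v x"
  shows "(\<Sum>t<n. universal_entry \<alpha> \<beta> \<gamma> \<eta> G (vs k ! s) (vs j ! t) * x $ t) =
    (if k = j then e * \<alpha> + (real r + H_deg H k) * \<beta> + \<gamma> else rho H k j * \<alpha>) * x $ s
    + \<eta> * (\<Sum>t<n. x $ t)"
proof (cases "k = j")
  case True
  have "(adjacency_mat (vs j) (Hs j) *\<^sub>v x) $ s = e * x $ s"
    using eig x s by simp
  moreover have "(adjacency_mat (vs j) (Hs j) *\<^sub>v x) $ s =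
      (\<Sum>t<n. (if (vs j ! s, vs j ! t) \<in> parcs (Hs j) then 1 else 0) * x $ t)"
    using s x length_vs[OF j]
    by (auto simp: adjacency_mat_def scalar_prod_def atLeast0LessThan intro!: sum.cong)
  ultimately have A: "(\<Sum>t<n. (if (vs j ! s, vs j ! t) \<in> parcs (Hs j) then 1 else 0) * x $ t) =
      e * x $ s"
    by simp
  have "(\<Sum>t<n. universal_entry \<alpha> \<beta> \<gamma> \<eta> G (vs k ! s) (vs j ! t) * x $ t) =
      (\<Sum>t<n. \<alpha> * ((if (vs j ! s, vs j ! t) \<in> parcs (Hs j) then 1 else 0) * x $ t)
        + (if t = s then (\<beta> * (real r + H_deg H k) + \<gamma>) * x $ s else 0) + \<eta> * x $ t)"
    using True j s reg
    by (intro sum.cong refl)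
      (auto simp: universal_entry_def parcs_G_iff vs_nth_eq_iff out_degree_G algebra_simps)
  also have "\<dots> = \<alpha> * (e * x $ s) + (\<beta> * (real r + H_deg H k) + \<gamma>) * x $ s + \<eta> * (\<Sum>t<n. x $ t)"
    using s by (simp add: sum.distrib A flip: sum_distrib_left)
  finally show ?thesis
    using True by (simp add: algebra_simps)
next
  case False
  have "(\<Sum>t<n. universal_entry \<alpha> \<beta> \<gamma> \<eta> G (vs k ! s) (vs j ! t) * x $ t) =
      (\<Sum>t<n. (if t = s then rho H k j * \<alpha> * x $ s else 0) + \<eta> * x $ t)"
    using False j k s
    by (intro sum.cong refl)
      (auto simp: universal_entry_def parcs_G_iff vs_nth_eq_iff rho_def algebra_simps)
  then show ?thesis
    using False s by (simp add: sum.distrib flip: sum_distrib_left)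
qed

text \<open>The sum of indicators spares an inverse of the enumeration \<open>vs j\<close>;
  distinctness leaves at most one nonzero term for \<open>j\<close> in the index range.\<close>

definition lift_vec :: "nat \<Rightarrow> real vec \<Rightarrow> 'a \<Rightarrow> real" where
  "lift_vec j x v = (\<Sum>t<n. if v = vs j ! t then x $ t else 0)"

lemma lift_vec_nth:
  fixes x :: "real vec"
  assumes "j \<in> {1..l}" "k \<in> {1..l}" "s < n"
  shows "lift_vec j x (vs k ! s) = (if k = j then x $ s else 0)"
proof -
  have "lift_vec j x (vs k ! s) = (\<Sum>t<n. if t = s then if k = j then x $ s else 0 else 0)"
    unfolding lift_vec_def using assms by (intro sum.cong) (auto simp: vs_nth_eq_iff)
  then show ?thesis
    using assms by simp
qed

lemma sum_lift_vec:
  fixes x :: "real vec"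
  assumes j: "j \<in> {1..l}"
  shows "(\<Sum>v\<in>pverts G. f v * lift_vec j x v) = (\<Sum>t<n. f (vs j ! t) * x $ t)"
proof -
  have "(\<Sum>v\<in>pverts G. f v * lift_vec j x v) =
      (\<Sum>k\<in>{1..l}. if k = j then \<Sum>t<n. f (vs j ! t) * x $ t else 0)"
    unfolding sum_pverts_G using j by (intro sum.cong refl) (auto simp: lift_vec_nth)
  then show ?thesis
    using j by simp
qed

text \<open>Column \<open>i l + j\<close> is the vector \<open>u\<^sub>i\<^sub>+\<^sub>1\<close> supported on \<open>H\<^sub>j\<^sub>+\<^sub>1\<close>, where \<open>i < n\<close> and \<open>j < l\<close>.\<close>

definition lift_mat :: "'a list \<Rightarrow> (nat \<Rightarrow> real vec) \<Rightarrow> real mat" where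
  "lift_mat ws u = mat (n * l) (n * l)
     (\<lambda>(a, c). lift_vec (Suc (c mod l)) (u (Suc (c div l))) (ws ! a))"

lemma lift_mat_carrier [simp]: "lift_mat ws u \<in> carrier_mat (n * l) (n * l)"
  by (simp add: lift_mat_def)

section \<open>Change of basis to the lifted eigenvectors\<close>

context
  fixes ws :: "'a list"
  assumes ws: "vertex_ordering G ws"
begin

lemma distinct_ws: "distinct ws" and set_ws: "set ws = pverts G"
  using ws by (auto simp: vertex_ordering_def)

text \<open>Here the choice of the ordering \<open>ws\<close> drops out: sums over matrix positions
  become sums over vertices.\<close>

lemma sum_ws: "(\<Sum>a<length ws. f (ws ! a)) = (\<Sum>v\<in>pverts G. f v)"
  using sum.reindex_bij_betw[OF bij_betw_nth[OF distinct_ws refl set_ws[symmetric]]] .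

lemma length_ws: "length ws = n * l"
  using sum_ws[of "\<lambda>_. 1 :: nat"] sum_pverts_G[of "\<lambda>_. 1 :: nat"] by simp

text \<open>Columns for different factors have disjoint supports; for the same factor their inner
  product is that of the underlying vectors \<open>u i\<close>.\<close>

lemma lift_mat_orthonormal:
  fixes u :: "nat \<Rightarrow> real vec"
  assumes orth: "\<And>i k. i \<in> {1..n} \<Longrightarrow> k \<in> {1..n} \<Longrightarrow> u i \<bullet> u k = (if i = k then 1 else 0)"
    and u: "\<And>i. i \<in> {1..n} \<Longrightarrow> u i \<in> carrier_vec n"
  shows "(lift_mat ws u)\<^sup>T * lift_mat ws u = 1\<^sub>m (n * l)"
proof (rule eq_matI)
  fix c d
  assume "c < dim_row (1\<^sub>m (n * l) :: real mat)" "d < dim_col (1\<^sub>m (n * l) :: real mat)"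
  then have cd: "c < n * l" "d < n * l"
    by auto
  define i j i' j' where "i = Suc (c div l)" and "j = Suc (c mod l)"
    and "i' = Suc (d div l)" and "j' = Suc (d mod l)"
  have pos: "l > 0"
    using cd(1) by (cases l) auto
  have ij: "i \<in> {1..n}" "i' \<in> {1..n}" "j \<in> {1..l}" "j' \<in> {1..l}"
    using cd pos by (auto simp: i_def j_def i'_def j'_def less_mult_imp_div_less Suc_le_eq)
  have cd_iff: "c = d \<longleftrightarrow> i = i' \<and> j = j'"
    unfolding i_def j_def i'_def j'_def by (metis div_mod_decomp nat.inject)
  have "((lift_mat ws u)\<^sup>T * lift_mat ws u) $$ (c, d) =
      (\<Sum>a<length ws. lift_vec j (u i) (ws ! a) * lift_vec j' (u i') (ws ! a))"
    using cd by (simp add: lift_mat_def scalar_prod_def length_ws atLeast0LessThan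
        i_def j_def i'_def j'_def)
  also have "\<dots> = (\<Sum>t<n. lift_vec j (u i) (vs j' ! t) * u i' $ t)"
    using sum_ws[of "\<lambda>v. lift_vec j (u i) v * lift_vec j' (u i') v"] ij
    by (simp add: sum_lift_vec)
  also have "\<dots> = (if j = j' then u i \<bullet> u i' else 0)"
    using ij u[of i'] by (auto simp: lift_vec_nth scalar_prod_def atLeast0LessThan)
  also have "\<dots> = 1\<^sub>m (n * l) $$ (c, d)"
    using orth[of i i'] ij cd by (cases "i = i'") (simp_all add: cd_iff)
  finally show "((lift_mat ws u)\<^sup>T * lift_mat ws u) $$ (c, d) = 1\<^sub>m (n * l) $$ (c, d)" .
qed (auto simp: lift_mat_def)

text \<open>The hypothesis \<open>total\<close> makes \<open>m i\<close> the eigenvalue of the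
  all-ones matrix on \<open>u i\<close>, which puts all \<open>C i\<close> under one formula. For
  the row at position \<open>s\<close> of factor \<open>k\<close> and the column of
  \<open>u i\<close> on factor \<open>j\<close>, both sides equal \<open>u i $ s\<close> times the
  entry of \<open>C i\<close> for \<open>k\<close> and \<open>j\<close>.\<close>

lemma universal_adj_mat_lift_mat:
  fixes u :: "nat \<Rightarrow> real vec"
  assumes reg: "\<And>j. j \<in> {1..l} \<Longrightarrow> regular_of_degree (r j) (Hs j)"
    and u: "\<And>i. i \<in> {1..n} \<Longrightarrow> u i \<in> carrier_vec n"
    and eig: "\<And>i j. i \<in> {1..n} \<Longrightarrow> j \<in> {1..l} \<Longrightarrow>
      adjacency_mat (vs j) (Hs j) *\<^sub>v u i = ev i j \<cdot>\<^sub>v u i"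
    and total: "\<And>i s. i \<in> {1..n} \<Longrightarrow> s < n \<Longrightarrow> (\<Sum>t<n. u i $ t) = m i * u i $ s"
    and C: "\<And>i. i \<in> {1..n} \<Longrightarrow> C i = mat1 l (\<lambda>j k.
      (if j = k then ev i j * \<alpha> + (real (r j) + H_deg H j) * \<beta> + \<gamma> else rho H j k * \<alpha>) + m i * \<eta>)"
  shows "universal_adj_mat \<alpha> \<beta> \<gamma> \<eta> ws G * lift_mat ws u =
    lift_mat ws u * block_diag n l (\<lambda>i. C (Suc i))"
proof (rule eq_matI)
  let ?U = "universal_adj_mat \<alpha> \<beta> \<gamma> \<eta> ws G" and ?P = "lift_mat ws u"
    and ?M = "block_diag n l (\<lambda>i. C (Suc i))"
  have U: "?U \<in> carrier_mat (n * l) (n * l)"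
    using universal_adj_mat_carrier[of \<alpha> \<beta> \<gamma> \<eta> ws G] by (simp add: length_ws)
  show "dim_row (?U * ?P) = dim_row (?P * ?M)" "dim_col (?U * ?P) = dim_col (?P * ?M)"
    using U by (auto simp: lift_mat_def block_diag_def)
  fix a c
  assume "a < dim_row (?P * ?M)" "c < dim_col (?P * ?M)"
  then have ac: "a < n * l" "c < n * l"
    by (auto simp: lift_mat_def block_diag_def)
  define i j where "i = Suc (c div l)" and "j = Suc (c mod l)"
  have pos: "l > 0"
    using ac(1) by (cases l) auto
  have ij: "i \<in> {1..n}" "j \<in> {1..l}"
    using ac pos by (auto simp: i_def j_def less_mult_imp_div_less Suc_le_eq)
  have "ws ! a \<in> pverts G"
    using ac set_ws length_ws nth_mem by metis
  then obtain k s where ks: "k \<in> {1..l}" "s < n" "ws ! a = vs k ! s"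
    by (rule pverts_GE)
  have "(?U * ?P) $$ (a, c) =
      (\<Sum>b<length ws. universal_entry \<alpha> \<beta> \<gamma> \<eta> G (ws ! a) (ws ! b) * lift_vec j (u i) (ws ! b))"
    using ac U distinct_ws
    by (simp add: lift_mat_def scalar_prod_def length_ws atLeast0LessThan i_def j_def
        universal_adj_mat_entry)
  also have "\<dots> = (\<Sum>t<n. universal_entry \<alpha> \<beta> \<gamma> \<eta> G (vs k ! s) (vs j ! t) * u i $ t)"
    using sum_ws[of "\<lambda>v. universal_entry \<alpha> \<beta> \<gamma> \<eta> G (ws ! a) v * lift_vec j (u i) v"] ij ks
    by (simp add: sum_lift_vec)
  also have "\<dots> = ((if k = j then ev i j * \<alpha> + (real (r k) + H_deg H k) * \<beta> + \<gamma>
      else rho H k j * \<alpha>) + m i * \<eta>) * u i $ s"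
    using universal_entry_sum[OF ij(2) ks(1,2) reg[OF ks(1)] u[OF ij(1)] eig[OF ij]]
      total[OF ij(1) ks(2)]
    by (simp add: algebra_simps)
  \<comment> \<open>Factors count from 1 and matrix positions from 0, hence the shifts.\<close>
  also have "\<dots> = u i $ s * C i $$ (k - 1, j - 1)"
  proof -
    have "Suc (k - 1) = k" "Suc (j - 1) = j" "k - 1 < l" "j - 1 < l" "k - 1 = j - 1 \<longleftrightarrow> k = j"
      using ij ks by auto
    then show ?thesis
      unfolding C[OF ij(1)] mat1_def by (cases "k = j") simp_all
  qed
  finally have lhs: "(?U * ?P) $$ (a, c) = u i $ s * C i $$ (k - 1, j - 1)" .

  \<comment> \<open>Among the \<open>l\<close> lifts of one vector, only the one supported on factor
    \<open>k\<close> is nonzero at a vertex of that factor.\<close>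
  have row: "(\<Sum>q<l. lift_vec (Suc q) x (vs k ! s) * f q) = x $ s * f (k - 1)" for x f
  proof -
    have "(\<Sum>q<l. lift_vec (Suc q) x (vs k ! s) * f q) =
        (\<Sum>q<l. if q = k - 1 then x $ s * f (k - 1) else 0)"
      using ks by (intro sum.cong refl) (auto simp: lift_vec_nth)
    also have "\<dots> = x $ s * f (k - 1)"
      using ks by auto
    finally show ?thesis .
  qed
  have "(?P * ?M) $$ (a, c) = (\<Sum>b<n * l. lift_vec (Suc (b mod l)) (u (Suc (b div l))) (vs k ! s) *
      (if b div l = c div l then C (Suc (b div l)) $$ (b mod l, c mod l) else 0))"
    using ac ks(3) by (simp add: lift_mat_def block_diag_def scalar_prod_def atLeast0LessThan)
  also have "\<dots> = (\<Sum>p<n. \<Sum>q<l. lift_vec (Suc q) (u (Suc p)) (vs k ! s) *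
      (if p = c div l then C (Suc p) $$ (q, c mod l) else 0))"
    by (rule sum_div_mod)
  \<comment> \<open>Block diagonality leaves the single block \<open>p = c div l\<close>, that is,
    the one of \<open>u i\<close>.\<close>
  also have "\<dots> = (\<Sum>p<n. if p = c div l then u i $ s * C i $$ (k - 1, c mod l) else 0)"
    by (intro sum.cong refl) (auto simp: row i_def)
  also have "\<dots> = u i $ s * C i $$ (k - 1, j - 1)"
    using ij ks by (auto simp: i_def j_def)
  finally show "(?U * ?P) $$ (a, c) = (?P * ?M) $$ (a, c)"
    using lhs by simp
qed

end

text \<open>The first entry of the eigenvalue equation compares \<open>c\<close> times a row sum,
  which is a degree, with \<open>e * c\<close>.\<close>

lemma eigenvalue_of_ones:
  assumes j: "j \<in> {1..l}" and reg: "regular_of_degree r (Hs j)" and n: "n \<ge> 1" and c: "c \<noteq> 0"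
    and eig: "adjacency_mat (vs j) (Hs j) *\<^sub>v (c \<cdot>\<^sub>v ones_vec n) = e \<cdot>\<^sub>v (c \<cdot>\<^sub>v ones_vec n)"
  shows "e = real r"
proof -
  have "real r = real (out_degree (with_proj (Hs j)) (vs j ! 0))"
    using reg j n vs_nth_in by (simp add: regular_of_degree_def)
  also have "\<dots> = (\<Sum>t<n. if (vs j ! 0, vs j ! t) \<in> parcs (Hs j) then 1 else 0)"
    by (simp add: real_out_degree_eq_sum[OF finite_pverts_Hs[OF j] parcs_Hs_subset[OF j]]
        sum_pverts_Hs[OF j])
  finally have r: "real r = (\<Sum>t<n. if (vs j ! 0, vs j ! t) \<in> parcs (Hs j) then 1 else 0)" .
  have "(adjacency_mat (vs j) (Hs j) *\<^sub>v (c \<cdot>\<^sub>v ones_vec n)) $ 0 =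
      (\<Sum>t<n. c * (if (vs j ! 0, vs j ! t) \<in> parcs (Hs j) then 1 else 0))"
    using n length_vs[OF j]
    by (auto simp: adjacency_mat_def ones_vec_def scalar_prod_def atLeast0LessThan intro!: sum.cong)
  also have "\<dots> = c * real r"
    by (simp only: r sum_distrib_left)
  finally show ?thesis
    unfolding eig using n c by (simp add: ones_vec_def)
qed

end

section \<open>The spectrum of the product\<close>

theorem theorem3p2:
  fixes H :: "nat pair_pre_digraph"
    and Hs :: "nat \<Rightarrow> 'a pair_pre_digraph"
    and vs :: "nat \<Rightarrow> 'a list"
    and ws :: "'a list"
    and l n :: nat
    and r :: "nat \<Rightarrow> nat"
    and u :: "nat \<Rightarrow> real vec"
    and ev :: "nat \<Rightarrow> nat \<Rightarrow> real"
    and \<alpha> \<beta> \<gamma> \<eta> :: real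
    and C :: "nat \<Rightarrow> real mat"
  assumes "n \<ge> 1"
    and "pair_graph H" and "pverts H = {1..l}"
    and "\<And>j. j \<in> {1..l} \<Longrightarrow> pair_graph (Hs j)"
    and "\<And>j. j \<in> {1..l} \<Longrightarrow> card (pverts (Hs j)) = n"
    and "\<And>j. j \<in> {1..l} \<Longrightarrow> vertex_ordering (Hs j) (vs j)"
    and "disjoint_family_on (\<lambda>j. pverts (Hs j)) {1..l}"
    and "\<And>j k. j \<in> {1..l} \<Longrightarrow> k \<in> {1..l} \<Longrightarrow>
           adjacency_mat (vs j) (Hs j) * adjacency_mat (vs k) (Hs k)
           = adjacency_mat (vs k) (Hs k) * adjacency_mat (vs j) (Hs j)"
    and "\<And>j. j \<in> {1..l} \<Longrightarrow> regular_of_degree (r j) (Hs j)"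
    and "orthonormal_basis n u"
    and "u 1 = (1 / sqrt (real n)) \<cdot>\<^sub>v ones_vec n"
    and "\<And>i j. i \<in> {1..n} \<Longrightarrow> j \<in> {1..l} \<Longrightarrow>
           eigenvector (adjacency_mat (vs j) (Hs j)) (u i) (ev i j)"
    and "\<alpha> \<noteq> 0"
    and "vertex_ordering (H_product H Hs vs) ws"
    and "C 1 = mat1 l (\<lambda>j k. if j = k
           then \<alpha> * real (r j) + (real (r j) + H_deg H j) * \<beta> + \<gamma> + real n * \<eta>
           else rho H j k * \<alpha> + real n * \<eta>)"
    and "\<And>i. i \<in> {2..n} \<Longrightarrow> C i = mat1 l (\<lambda>j k. if j = k
           then ev i j * \<alpha> + (real (r j) + H_deg H j) * \<beta> + \<gamma>
           else rho H j k * \<alpha>)"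
  shows "spectrum_mset (universal_adj_mat \<alpha> \<beta> \<gamma> \<eta> ws (H_product H Hs vs))
         = spectrum_mset (C 1) + (\<Sum>i\<in>{2..n}. spectrum_mset (C i))"
proof -
  interpret H_product_family H Hs vs l n
    by (rule H_product_family.intro) (fact assms)+
  \<comment> \<open>The eigenvalue of the all-ones matrix: \<open>n\<close> on the constant vectors,
    0 on their orthogonal complement.\<close>
  define m where "m i = (if i = 1 then real n else 0)" for i :: nat
  interpret V: vec_space "TYPE(real)" n .
  have orth: "u i \<bullet> u k = (if i = k then 1 else 0)" if "i \<in> {1..n}" "k \<in> {1..n}" for i k
    using assms(10) that by (auto simp: orthonormal_basis_def)
  have u: "u i \<in> carrier_vec n" if "i \<in> {1..n}" for i
    using assms(10) that by (auto simp: orthonormal_basis_def V.basis_def)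
  have eig: "adjacency_mat (vs j) (Hs j) *\<^sub>v u i = ev i j \<cdot>\<^sub>v u i"
    if "i \<in> {1..n}" "j \<in> {1..l}" for i j
    using assms(12)[OF that] by (simp add: eigenvector_def)
  \<comment> \<open>The entries of \<open>u 1\<close> are all equal; any other \<open>u i\<close> is
    orthogonal to \<open>u 1\<close>, so its entries sum to 0.\<close>
  have total: "(\<Sum>t<n. u i $ t) = m i * u i $ s" if i: "i \<in> {1..n}" and s: "s < n" for i s
  proof (cases "i = 1")
    case True
    then show ?thesis
      using s assms(11) by (simp add: m_def ones_vec_def)
  next
    case False
    have "u 1 \<bullet> u i = 0"
      using orth[of 1 i] i False by auto
    moreover have "u 1 \<bullet> u i = 1 / sqrt (real n) * (\<Sum>t<n. u i $ t)"
      using u[OF i] assms(11)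
      by (simp add: scalar_prod_def ones_vec_def atLeast0LessThan sum_divide_distrib)
    ultimately show ?thesis
      using False assms(1) by (simp add: m_def)
  qed
  \<comment> \<open>\<open>C 1\<close> is given in terms of \<open>r j\<close>, whereas the common
    formula uses \<open>ev 1 j\<close>.\<close>
  have ev1: "ev 1 j = real (r j)" if "j \<in> {1..l}" for j
    using eigenvalue_of_ones[OF that assms(9)[OF that] assms(1), of "1 / sqrt (real n)" "ev 1 j"]
      eig[of 1 j] that assms(1,11) by simp
  have C: "C i = mat1 l (\<lambda>j k. (if j = k then ev i j * \<alpha> + (real (r j) + H_deg H j) * \<beta> + \<gamma>
      else rho H j k * \<alpha>) + m i * \<eta>)" if "i \<in> {1..n}" for i
  proof (cases "i = 1")
    case True
    then show ?thesis
      using assms(15) ev1 by (auto simp: mat1_def m_def intro!: eq_matI)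
  next
    case False
    then show ?thesis
      using assms(16)[of i] that by (auto simp: mat1_def m_def intro!: eq_matI)
  qed
  have carrier: "C (Suc i) \<in> carrier_mat l l" if "i < n" for i
    using C[of "Suc i"] that by (simp add: mat1_def)
  let ?U = "universal_adj_mat \<alpha> \<beta> \<gamma> \<eta> ws G"
  have U: "?U \<in> carrier_mat (n * l) (n * l)"
    using universal_adj_mat_carrier[of \<alpha> \<beta> \<gamma> \<eta> ws G] by (simp add: length_ws[OF assms(14)])
  have "char_poly ?U = char_poly (block_diag n l (\<lambda>i. C (Suc i)))"
    by (rule char_poly_intertwined[OF U block_diag_carrier lift_mat_carrier[of ws u]
          lift_mat_orthonormal[OF assms(14) orth u]
          universal_adj_mat_lift_mat[OF assms(14) assms(9) u eig total C]])
  then have "spectrum_mset ?U = (\<Sum>i<n. spectrum_mset (C (Suc i)))"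
    using spectrum_mset_block_diag[OF U, of n "\<lambda>i. C (Suc i)" l] carrier by blast
  \<comment> \<open>Blocks are numbered from 0, eigenvectors from 1.\<close>
  also have "\<dots> = (\<Sum>i\<in>{1..n}. spectrum_mset (C i))"
    by (rule sum.reindex_bij_witness[of _ "\<lambda>i. i - 1" Suc]) auto
  also have "\<dots> = spectrum_mset (C 1) + (\<Sum>i\<in>{2..n}. spectrum_mset (C i))"
    using assms(1) by (simp add: sum.atLeast_Suc_atMost numeral_2_eq_2)
  finally show ?thesis .
qed

end
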